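(* Let $n\ge1$, $0<\alpha<n$, and $p,q>0$. (1) The equation $$u(x)=c(x)\int_{\mathbb{R}^n}\frac{u^p(y)\,dy}{|x-y|^{n-\alpha}},\quad x\in\mathbb{R}^n,$$ has positive solutions for some double bounded $c(x)$ if and only if $p>\frac{n}{n-\alpha}$. (2) The system $$u(x)=c_1(x)\int_{\mathbb{R}^n}\frac{v^q(y)\,dy}{|x-y|^{n-\alpha}},\qquad v(x)=c_2(x)\int_{\mathbb{R}^n}\frac{u^p(y)\,dy}{|x-y|^{n-\alpha}},\quad x\in\mathbb{R}^n,$$ has positive solutions $u,v$ for some double bounded $c_1(x)$ and $c_2(x)$ if and only if $pq>1$ and $$\max\Big\{\frac{\alpha(p+1)}{pq-1},\ \frac{\alpha(q+1)}{pq-1}\Big\}<n-\alpha.$$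
   Context: A function $c:\mathbb{R}^n\to\mathbb{R}$ is called double bounded if there is a constant $C>0$ such that $\frac1C\le c(x)\le C$ for all $x\in\mathbb{R}^n$. Solutions are positive, finite-valued functions on $\mathbb{R}^n$. *)

theory Defs
  imports "HOL-Analysis.Analysis"
begin

definition double_bounded :: "('a \<Rightarrow> real) \<Rightarrow> bool" where
  "double_bounded c \<longleftrightarrow> (\<exists>C>0. \<forall>x. 1 / C \<le> c x \<and> c x \<le> C)"

text \<open>
  The integral below is the Lebesgue integral of a nonnegative function, with values in
  \<open>[0, \<infinity>]\<close>. On the null set \<open>y = x\<close> the kernel evaluates to \<open>0\<close>, because \<open>0 powr a = 0\<close>
  and \<open>z / 0 = 0\<close>.
\<close>

definition riesz_integral :: "real \<Rightarrow> (real ^ 'n \<Rightarrow> real) \<Rightarrow> real ^ 'n \<Rightarrow> ennreal" where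
  "riesz_integral \<alpha> f x =
     (\<integral>\<^sup>+ y. ennreal (f y / norm (x - y) powr (real CARD('n) - \<alpha>)) \<partial>lebesgue)"

text \<open>
  Measurability is required explicitly since it is what makes the integrals meaningful.
  Solutions are real-valued and the equations hold in \<open>[0, \<infinity>]\<close> at every point \<open>x\<close>, so the
  integrals are finite wherever the coefficient is positive.
\<close>

definition positive_solution ::
    "real \<Rightarrow> real \<Rightarrow> (real ^ 'n \<Rightarrow> real) \<Rightarrow> (real ^ 'n \<Rightarrow> real) \<Rightarrow> bool" where
  "positive_solution \<alpha> p c u \<longleftrightarrow>
     u \<in> borel_measurable lebesgue \<and> (\<forall>x. 0 < u x) \<and>
     (\<forall>x. ennreal (u x) = ennreal (c x) * riesz_integral \<alpha> (\<lambda>y. u y powr p) x)"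

definition positive_system_solution ::
    "real \<Rightarrow> real \<Rightarrow> real \<Rightarrow> (real ^ 'n \<Rightarrow> real) \<Rightarrow> (real ^ 'n \<Rightarrow> real)
      \<Rightarrow> (real ^ 'n \<Rightarrow> real) \<Rightarrow> (real ^ 'n \<Rightarrow> real) \<Rightarrow> bool" where
  "positive_system_solution \<alpha> p q c1 c2 u v \<longleftrightarrow>
     u \<in> borel_measurable lebesgue \<and> v \<in> borel_measurable lebesgue \<and>
     (\<forall>x. 0 < u x) \<and> (\<forall>x. 0 < v x) \<and>
     (\<forall>x. ennreal (u x) = ennreal (c1 x) * riesz_integral \<alpha> (\<lambda>y. v y powr q) x) \<and>
     (\<forall>x. ennreal (v x) = ennreal (c2 x) * riesz_integral \<alpha> (\<lambda>y. u y powr p) x)"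

end

theory Submission
  imports Defs
begin

text \<open>
  Write \<open>N = n - \<alpha>\<close> for the exponent of the kernel. The scalar equation is the system with
  \<open>q = p\<close> and \<open>v = u\<close>, and \<open>scalar_condition_iff\<close> identifies the two conditions, so the
  system carries the proof.

  Existence rests on explicit functions. For \<open>\<alpha> < \<beta> < n\<close> the potential of
  \<open>(1 + norm y) powr (- \<beta>)\<close> is comparable to \<open>(1 + norm x) powr (\<alpha> - \<beta>)\<close>, as the integrals
  over dyadic shells show, and a double bounded coefficient turns comparability into equality
  (\<open>bracket_riesz_solution\<close>). The system for two such powers reduces to a linear system for
  their decay rates. Its solution is \<open>\<alpha> * (q + 1) / (p * q - 1)\<close> and
  \<open>\<alpha> * (p + 1) / (p * q - 1)\<close>, and the condition of the theorem says that both rates are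
  below \<open>N\<close>, which is what the comparison requires.

  For necessity let \<open>a r\<close> and \<open>b r\<close> be the integrals of \<open>u powr p\<close> and \<open>v powr q\<close> over the ball
  of radius \<open>r\<close> about the origin. On a ball of comparable radius the kernel is at least a multiple
  of \<open>r powr (- N)\<close>, so \<open>u\<close> is at least of order \<open>r powr (- N) * b r\<close> and \<open>v\<close> at least of
  order \<open>r powr (- N) * a r\<close>. Raising these to the powers \<open>p\<close>, \<open>q\<close> and integrating gives
  \<open>K * r powr e * a r powr (p * q) \<le> a r\<close> with \<open>e = \<alpha> * (p + 1) - N * (p * q - 1)\<close>. The same
  bound holds for the integral over the annulus between the radii \<open>r\<close> and \<open>2 * r\<close>, that is, for
  \<open>a (2 * r) - a r\<close>. Since the potential of \<open>u powr p\<close> is finite at the origin, \<open>a r\<close> is also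
  at most a multiple of \<open>r powr N\<close>. By \<open>growth_dichotomy\<close> these inequalities force \<open>p * q > 1\<close>
  and \<open>e < 0\<close>; the annulus is what excludes the borderline \<open>e = 0\<close>. The condition \<open>e < 0\<close> is one
  half of the maximum condition, and exchanging the two functions gives the other half.
\<close>

section \<open>Integrals of powers of the distance\<close>

lemma emeasure_lebesgue_cball:
  fixes c :: "'a::euclidean_space"
  assumes "0 < r"
  shows "emeasure lebesgue (cball c r) = ennreal (unit_ball_vol (real DIM('a)) * r powr real DIM('a))"
  using emeasure_cball[of r c] assms by (simp add: powr_realpow)

text \<open>
  A power of the distance to \<open>x\<close> is comparable to a constant on each dyadic shell, so its
  integral is a geometric series with ratio \<open>l powr (n - s)\<close>. The parameter \<open>l\<close> is \<open>1 / 2\<close> for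
  shells that shrink to \<open>x\<close> and \<open>2\<close> for shells that go to infinity; this covers the two ranges
  \<open>s < n\<close> and \<open>s > n\<close> at once. The point \<open>x\<close> lies in no shell, but the integrand vanishes there
  by convention.
\<close>

lemma nn_integral_dyadic_powr_le:
  fixes x :: "'a::euclidean_space"
  defines "n \<equiv> real DIM('a)"
  assumes \<rho>: "0 < \<rho>" and l: "0 < l" "l powr (n - s) < 1" and s: "0 \<le> s"
    and D: "D \<in> sets lebesgue"
    and cover: "\<And>y. y \<in> D \<Longrightarrow> y \<noteq> x \<Longrightarrow> \<exists>k::nat. \<rho> * l ^ k \<le> norm (x - y) \<and> norm (x - y) \<le> 2 * (\<rho> * l ^ k)"
  shows "(\<integral>\<^sup>+y. ennreal (norm (x - y) powr (- s)) * indicator D y \<partial>lebesgue)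
    \<le> ennreal (2 powr n * unit_ball_vol n / (1 - l powr (n - s)) * \<rho> powr (n - s))"
proof -
  let ?g = "\<lambda>k y. ennreal ((\<rho> * l ^ k) powr (- s)) * indicator (cball x (2 * (\<rho> * l ^ k))) y"
  have term_le: "h k \<le> suminf h" for h :: "nat \<Rightarrow> ennreal" and k
    using sum_le_suminf[of h "{k}"] by simp
  have pt: "ennreal (norm (x - y) powr (- s)) * indicator D y \<le> (\<Sum>k. ?g k y)" for y
  proof (cases "y \<in> D \<and> y \<noteq> x")
    case True
    then obtain k where k: "\<rho> * l ^ k \<le> norm (x - y)" "norm (x - y) \<le> 2 * (\<rho> * l ^ k)"
      using cover by blast
    have "norm (x - y) powr (- s) \<le> (\<rho> * l ^ k) powr (- s)"
      using k(1) \<rho> l s by (intro powr_mono2') auto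
    then have "ennreal (norm (x - y) powr (- s)) * indicator D y \<le> ?g k y"
      using True k(2) by (simp add: dist_norm ennreal_leI)
    also have "\<dots> \<le> (\<Sum>k. ?g k y)"
      by (rule term_le)
    finally show ?thesis .
  qed auto
  (* Each shell contributes its volume times the largest value of the kernel there. The power
     of the scale that comes out is n - s, which makes the series geometric. *)
  have shell: "(\<integral>\<^sup>+y. ?g k y \<partial>lebesgue)
      = ennreal (2 powr n * unit_ball_vol n * \<rho> powr (n - s) * (l powr (n - s)) ^ k)" for k
  proof -
    let ?t = "\<rho> * l ^ k"
    have t: "0 < ?t" using \<rho> l by simp
    have "(\<integral>\<^sup>+y. ?g k y \<partial>lebesgue) = ennreal (?t powr (- s)) * emeasure lebesgue (cball x (2 * ?t))"
      by (simp add: nn_integral_cmult_indicator)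
    also have "\<dots> = ennreal (?t powr (- s) * (unit_ball_vol n * (2 * ?t) powr n))"
      using t by (subst emeasure_lebesgue_cball) (auto simp: n_def ennreal_mult'[symmetric])
    also have "?t powr (- s) * (unit_ball_vol n * (2 * ?t) powr n)
        = 2 powr n * unit_ball_vol n * ?t powr (n - s)"
      using t by (simp add: powr_mult powr_diff powr_minus divide_inverse)
    also have "?t powr (n - s) = \<rho> powr (n - s) * (l powr (n - s)) ^ k"
      using \<rho> l by (simp add: powr_mult powr_powr mult.commute flip: powr_realpow)
    finally show ?thesis by (simp add: mult_ac)
  qed
  have "(\<integral>\<^sup>+y. ennreal (norm (x - y) powr (- s)) * indicator D y \<partial>lebesgue)
      \<le> (\<integral>\<^sup>+y. (\<Sum>k. ?g k y) \<partial>lebesgue)"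
    by (intro nn_integral_mono pt)
  also have "\<dots> = (\<Sum>k. \<integral>\<^sup>+y. ?g k y \<partial>lebesgue)"
    by (rule nn_integral_suminf) (intro borel_measurable_times_ennreal borel_measurable_indicator; simp)
  also have "\<dots> = ennreal (2 powr n * unit_ball_vol n * \<rho> powr (n - s) * (1 / (1 - l powr (n - s))))"
    unfolding shell
  proof (intro suminf_ennreal_eq sums_mult geometric_sums)
    show "0 \<le> 2 powr n * unit_ball_vol n * \<rho> powr (n - s) * (l powr (n - s)) ^ k" for k
      by (simp add: n_def)
    show "norm (l powr (n - s)) < 1" using l by simp
  qed
  also have "2 powr n * unit_ball_vol n * \<rho> powr (n - s) * (1 / (1 - l powr (n - s)))
      = 2 powr n * unit_ball_vol n / (1 - l powr (n - s)) * \<rho> powr (n - s)"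
    by simp
  finally show ?thesis .
qed

lemma halving_scale:
  fixes t r :: real
  assumes "0 < t" "t \<le> 2 * r"
  shows "\<exists>k::nat. r * (1 / 2) ^ k \<le> t \<and> t \<le> 2 * (r * (1 / 2) ^ k)"
proof -
  let ?P = "\<lambda>k. r * (1 / 2) ^ k \<le> t"
  have r: "0 < r" using assms by simp
  obtain k0 where "(1 / 2 :: real) ^ k0 < t / r"
    using real_arch_pow_inv[of "t / r" "1 / 2"] assms r by auto
  then have ex: "?P k0" using r by (simp add: field_simps)
  show ?thesis
  proof (cases "LEAST k. ?P k")
    case 0
    then have "?P 0" using LeastI[of ?P, OF ex] by simp
    then show ?thesis using assms by (intro exI[of _ 0]) simp
  next
    case (Suc j)
    have "?P (Suc j)" using LeastI[of ?P, OF ex] unfolding Suc .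
    moreover have "\<not> ?P j" using not_less_Least[of j ?P] Suc by simp
    ultimately show ?thesis by (intro exI[of _ "Suc j"]) simp
  qed
qed

lemma doubling_scale:
  fixes t r :: real
  assumes "0 < r" "r \<le> t"
  shows "\<exists>k::nat. r * 2 ^ k \<le> t \<and> t \<le> 2 * (r * 2 ^ k)"
proof -
  let ?P = "\<lambda>k. t \<le> 2 * (r * 2 ^ k)"
  obtain k0 where "t / r < (2::real) ^ k0"
    using real_arch_pow[of 2 "t / r"] by auto
  then have ex: "?P k0" using assms by (simp add: field_simps)
  show ?thesis
  proof (cases "LEAST k. ?P k")
    case 0
    then have "?P 0" using LeastI[of ?P, OF ex] by simp
    then show ?thesis using assms by (intro exI[of _ 0]) simp
  next
    case (Suc j)
    have "?P (Suc j)" using LeastI[of ?P, OF ex] unfolding Suc .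
    moreover have "\<not> ?P j" using not_less_Least[of j ?P] Suc by simp
    ultimately show ?thesis by (intro exI[of _ "Suc j"]) simp
  qed
qed

lemma nn_integral_powr_cball_le:
  fixes s :: real
  assumes s: "0 \<le> s" "s < real DIM('a::euclidean_space)"
  obtains C where "0 \<le> C"
    "\<And>(x::'a) r. 0 < r \<Longrightarrow>
      (\<integral>\<^sup>+y. ennreal (norm (x - y) powr (- s)) * indicator (cball x r) y \<partial>lebesgue)
        \<le> ennreal (C * r powr (real DIM('a) - s))"
proof
  let ?n = "real DIM('a)"
  let ?C = "2 powr ?n * unit_ball_vol ?n / (1 - (1/2) powr (?n - s))"
  have l: "(1/2::real) powr (?n - s) < 1"
    using s powr_less_mono2[of "?n - s" "1/2" 1] by simp
  show "0 \<le> ?C * (1/2) powr (?n - s)" using l by simp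
  fix x :: 'a and r :: real assume r: "0 < r"
  have "(\<integral>\<^sup>+y. ennreal (norm (x - y) powr (- s)) * indicator (cball x r) y \<partial>lebesgue)
      \<le> ennreal (?C * (r / 2) powr (?n - s))"
    using r l s
    by (intro nn_integral_dyadic_powr_le[where l = "1/2"] halving_scale) (auto simp: dist_norm)
  also have "?C * (r / 2) powr (?n - s) = ?C * (1/2) powr (?n - s) * r powr (?n - s)"
    using r by (simp add: powr_divide)
  finally show "(\<integral>\<^sup>+y. ennreal (norm (x - y) powr (- s)) * indicator (cball x r) y \<partial>lebesgue)
      \<le> ennreal (?C * (1/2) powr (?n - s) * r powr (?n - s))" .
qed

lemma nn_integral_powr_outside_ball_le:
  fixes s :: real
  assumes s: "real DIM('a::euclidean_space) < s"
  obtains C where "0 \<le> C"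
    "\<And>(x::'a) r. 0 < r \<Longrightarrow>
      (\<integral>\<^sup>+y. ennreal (norm (x - y) powr (- s)) * indicator (- ball x r) y \<partial>lebesgue)
        \<le> ennreal (C * r powr (real DIM('a) - s))"
proof
  let ?n = "real DIM('a)"
  let ?C = "2 powr ?n * unit_ball_vol ?n / (1 - 2 powr (?n - s))"
  have l: "(2::real) powr (?n - s) < 1"
    using s by (simp add: powr_less_one)
  show "0 \<le> ?C" using l by simp
  fix x :: 'a and r :: real assume r: "0 < r"
  show "(\<integral>\<^sup>+y. ennreal (norm (x - y) powr (- s)) * indicator (- ball x r) y \<partial>lebesgue)
      \<le> ennreal (?C * r powr (?n - s))"
    using r l s
    by (intro nn_integral_dyadic_powr_le[where l = 2] doubling_scale) (auto simp: dist_norm)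
qed

section \<open>Riesz potentials of powers of one plus the norm\<close>

text \<open>
  The kernel is at least \<open>d powr (- (n - \<alpha>))\<close> at distance at most \<open>d\<close>. It serves in two
  ways: as a lower bound for the potential, and, where the potential is finite, as an upper bound
  for the mass of \<open>f\<close> on \<open>S\<close>.
\<close>

lemma riesz_integral_ge:
  fixes x :: "real ^ 'n::finite"
  assumes f: "f \<in> borel_measurable lebesgue" "\<And>y. 0 \<le> f y"
    and S: "S \<in> sets lebesgue" "\<And>y. y \<in> S \<Longrightarrow> norm (x - y) \<le> d"
    and \<alpha>: "\<alpha> \<le> real CARD('n)"
  shows "ennreal (d powr (- (real CARD('n) - \<alpha>))) * (\<integral>\<^sup>+y. ennreal (f y) * indicator S y \<partial>lebesgue)
    \<le> riesz_integral \<alpha> f x"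
proof -
  let ?N = "real CARD('n) - \<alpha>"
  have "ennreal (d powr (- ?N)) * (\<integral>\<^sup>+y. ennreal (f y) * indicator S y \<partial>lebesgue)
      = (\<integral>\<^sup>+y. ennreal (d powr (- ?N)) * (ennreal (f y) * indicator S y) \<partial>lebesgue)"
    using f S by (intro nn_integral_cmult[symmetric] borel_measurable_times borel_measurable_indicator) auto
  also have "\<dots> \<le> riesz_integral \<alpha> f x"
    unfolding riesz_integral_def
  proof (rule nn_integral_mono_AE)
    (* At y = x the quotient in the kernel is 0 by convention, so the bound fails at that point. *)
    have "AE y in lebesgue. y \<noteq> x"
      by (intro AE_I'[of "{x}"]) (auto simp: negligible_iff_null_sets[symmetric])
    then show "AE y in lebesgue. ennreal (d powr (- ?N)) * (ennreal (f y) * indicator S y)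
        \<le> ennreal (f y / norm (x - y) powr ?N)"
    proof eventually_elim
      case (elim y)
      show ?case
      proof (cases "y \<in> S")
        case True
        have "d powr (- ?N) \<le> norm (x - y) powr (- ?N)"
          using S(2)[OF True] elim \<alpha> by (intro powr_mono2') auto
        then have "d powr (- ?N) * f y \<le> norm (x - y) powr (- ?N) * f y"
          by (rule mult_right_mono) (rule f(2))
        also have "\<dots> = f y / norm (x - y) powr ?N"
          by (simp only: powr_minus divide_inverse mult.commute)
        finally show ?thesis using True
          by (simp add: ennreal_leI ennreal_mult'[symmetric])
      qed simp
    qed
  qed
  finally show ?thesis .
qed

text \<open>
  The ball of radius \<open>r = 1 + norm x\<close> about the origin alone gives the right order: there both
  \<open>1 + norm y\<close> and the distance to \<open>x\<close> are at most \<open>2 * r\<close>.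
\<close>

lemma riesz_integral_bracket_ge:
  fixes x :: "real ^ 'n::finite"
  assumes \<alpha>: "\<alpha> < real CARD('n)" and \<beta>: "0 \<le> \<beta>"
  shows "ennreal (unit_ball_vol (real CARD('n)) * 2 powr (- (real CARD('n) - \<alpha> + \<beta>)) * (1 + norm x) powr (\<alpha> - \<beta>))
    \<le> riesz_integral \<alpha> (\<lambda>y. (1 + norm y) powr (- \<beta>)) x"
proof -
  let ?n = "real CARD('n)"
  let ?N = "?n - \<alpha>"
  let ?\<omega> = "unit_ball_vol ?n"
  define r where "r = 1 + norm x"
  have r: "1 \<le> r" by (simp add: r_def)
  have "ennreal ((2 * r) powr (- \<beta>) * (?\<omega> * r powr ?n))
      = ennreal ((2 * r) powr (- \<beta>)) * emeasure lebesgue (cball (0::real^'n) r)"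
    using r by (subst emeasure_lebesgue_cball)
      (auto simp: ennreal_mult'[symmetric])
  also have "\<dots> = (\<integral>\<^sup>+y. ennreal ((2 * r) powr (- \<beta>)) * indicator (cball (0::real^'n) r) y \<partial>lebesgue)"
    by (simp add: nn_integral_cmult_indicator)
  also have "\<dots> \<le> (\<integral>\<^sup>+y. ennreal ((1 + norm y) powr (- \<beta>)) * indicator (cball (0::real^'n) r) y \<partial>lebesgue)"
  proof (intro nn_integral_mono)
    fix y :: "real^'n"
    have "(2 * r) powr (- \<beta>) \<le> (1 + norm y) powr (- \<beta>)" if "norm y \<le> r"
      using that r \<beta> by (intro powr_mono2') (auto intro: add_pos_nonneg)
    then show "ennreal ((2 * r) powr (- \<beta>)) * indicator (cball 0 r) y
        \<le> ennreal ((1 + norm y) powr (- \<beta>)) * indicator (cball 0 r) y"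
      by (auto simp: indicator_def ennreal_leI)
  qed
  finally have "ennreal ((2 * r) powr (- ?N)) * ennreal ((2 * r) powr (- \<beta>) * (?\<omega> * r powr ?n))
      \<le> ennreal ((2 * r) powr (- ?N)) * (\<integral>\<^sup>+y. ennreal ((1 + norm y) powr (- \<beta>)) * indicator (cball (0::real^'n) r) y \<partial>lebesgue)"
    by (rule mult_left_mono) simp
  also have "\<dots> \<le> riesz_integral \<alpha> (\<lambda>y. (1 + norm y) powr (- \<beta>)) x"
  proof (rule riesz_integral_ge)
    have "(\<lambda>y::real^'n. (1 + norm y) powr (- \<beta>)) \<in> borel_measurable borel" by measurable
    then show "(\<lambda>y::real^'n. (1 + norm y) powr (- \<beta>)) \<in> borel_measurable lebesgue"
      by (intro measurable_completion) simp
    show "norm (x - y) \<le> 2 * r" if "y \<in> cball 0 r" for y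
      using that norm_triangle_ineq4[of x y] by (simp add: r_def)
  qed (use \<alpha> in auto)
  also have "ennreal ((2 * r) powr (- ?N)) * ennreal ((2 * r) powr (- \<beta>) * (?\<omega> * r powr ?n))
      = ennreal ((2 * r) powr (- ?N) * ((2 * r) powr (- \<beta>) * (?\<omega> * r powr ?n)))"
    using r by (simp add: ennreal_mult)
  also have "(2 * r) powr (- ?N) * ((2 * r) powr (- \<beta>) * (?\<omega> * r powr ?n))
      = ?\<omega> * 2 powr (- (?N + \<beta>)) * r powr (\<alpha> - \<beta>)"
  proof -
    have "(2 * r) powr (- ?N) * (2 * r) powr (- \<beta>) = 2 powr (- (?N + \<beta>)) * r powr (- (?N + \<beta>))"
    proof -
      have "(2 * r) powr (- ?N) * (2 * r) powr (- \<beta>) = (2 * r) powr (- (?N + \<beta>))"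
        by (simp only: powr_add minus_add_distrib)
      then show ?thesis using r by (simp only: powr_mult)
    qed
    moreover have "r powr (- (?N + \<beta>)) * r powr ?n = r powr (\<alpha> - \<beta>)"
      by (simp flip: powr_add)
    ultimately show ?thesis by (metis mult.assoc mult.left_commute)
  qed
  finally show ?thesis by (simp add: r_def)
qed

text \<open>
  With \<open>r = 1 + norm x\<close>, the space splits into three regions, on each of which one of the two
  factors of the integrand is controlled by a constant or by the other factor. The singularity at
  \<open>x\<close> is integrable because \<open>\<alpha> > 0\<close>, the ball about the origin contributes the right order
  because \<open>\<beta> < n\<close>, and the tail converges because \<open>\<beta> > \<alpha>\<close>. Each region contributes a
  multiple of \<open>r powr (\<alpha> - \<beta>)\<close>.
\<close>

lemma riesz_integral_bracket_le:
  fixes \<alpha> \<beta> :: real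
  assumes \<alpha>: "0 < \<alpha>" "\<alpha> < real CARD('n::finite)" and \<beta>: "\<alpha> < \<beta>" "\<beta> < real CARD('n)"
  obtains K where "\<And>x::real^'n. riesz_integral \<alpha> (\<lambda>y. (1 + norm y) powr (- \<beta>)) x
    \<le> ennreal (K * (1 + norm x) powr (\<alpha> - \<beta>))"
proof -
  let ?n = "real CARD('n)"
  let ?N = "?n - \<alpha>"
  obtain C1 where C1: "0 \<le> C1" "\<And>(x::real^'n) r. 0 < r \<Longrightarrow>
      (\<integral>\<^sup>+y. ennreal (norm (x - y) powr (- ?N)) * indicator (cball x r) y \<partial>lebesgue)
        \<le> ennreal (C1 * r powr (?n - ?N))"
    using nn_integral_powr_cball_le[of ?N, where 'a = "real^'n"] \<alpha> by auto
  obtain C2 where C2: "0 \<le> C2" "\<And>(x::real^'n) r. 0 < r \<Longrightarrow>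
      (\<integral>\<^sup>+y. ennreal (norm (x - y) powr (- \<beta>)) * indicator (cball x r) y \<partial>lebesgue)
        \<le> ennreal (C2 * r powr (?n - \<beta>))"
    using nn_integral_powr_cball_le[of \<beta>, where 'a = "real^'n"] \<alpha> \<beta> by auto
  obtain C3 where C3: "0 \<le> C3" "\<And>(x::real^'n) r. 0 < r \<Longrightarrow>
      (\<integral>\<^sup>+y. ennreal (norm (x - y) powr (- (?N + \<beta>))) * indicator (- ball x r) y \<partial>lebesgue)
        \<le> ennreal (C3 * r powr (?n - (?N + \<beta>)))"
    using nn_integral_powr_outside_ball_le[of "?N + \<beta>", where 'a = "real^'n"] \<alpha> \<beta> by auto
  let ?K = "C1 * 2 powr (\<beta> - (?n - ?N)) + C2 * 2 powr (?N + (?n - \<beta>)) + C3 * 2 powr (?N + (\<alpha> - \<beta>))"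
  show thesis
  proof
    fix x :: "real^'n"
    define r where "r = 1 + norm x"
    have r: "1 \<le> r" by (simp add: r_def)
    let ?k = "\<lambda>s D z y. ennreal (norm (z - y) powr (- s)) * indicator D (y::real^'n)"
    (* The regions are: y close to x, where 1 + norm y is comparable to r; y in the ball of radius
       2 r away from x, where the kernel is comparable to its value at distance r; and y far out,
       where the distance to x is comparable to norm y. *)
    have "riesz_integral \<alpha> (\<lambda>y. (1 + norm y) powr (- \<beta>)) x
      \<le> (\<integral>\<^sup>+y. ennreal ((r / 2) powr (- \<beta>)) * ?k ?N (cball x (r / 2)) x y
          + ennreal ((r / 2) powr (- ?N)) * ?k \<beta> (cball 0 (2 * r)) 0 y
          + ennreal (2 powr ?N) * ?k (?N + \<beta>) (- ball 0 (2 * r)) 0 y \<partial>lebesgue)"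
      unfolding riesz_integral_def
    proof (rule nn_integral_mono_AE)
      (* At y = 0 the power norm y powr (- \<beta>) is 0 by convention and bounds nothing. *)
      have "AE y in lebesgue. y \<noteq> (0::real^'n)"
        by (intro AE_I'[of "{0}"]) (auto simp: negligible_iff_null_sets[symmetric])
      then show "AE y in lebesgue. ennreal ((1 + norm y) powr (- \<beta>) / norm (x - y) powr ?N)
        \<le> ennreal ((r / 2) powr (- \<beta>)) * ?k ?N (cball x (r / 2)) x y
          + ennreal ((r / 2) powr (- ?N)) * ?k \<beta> (cball 0 (2 * r)) 0 y
          + ennreal (2 powr ?N) * ?k (?N + \<beta>) (- ball 0 (2 * r)) 0 y"
      proof eventually_elim
        case (elim y)
        have kern: "(1 + norm y) powr (- \<beta>) / norm (x - y) powr ?N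
            = (1 + norm y) powr (- \<beta>) * norm (x - y) powr (- ?N)"
          by (simp only: powr_minus divide_inverse)
        have tri: "norm x \<le> norm y + norm (x - y)" "norm y \<le> norm x + norm (x - y)"
          using norm_triangle_sub[of x y] norm_triangle_sub[of y x] by (auto simp: norm_minus_commute)
        consider "y \<in> cball x (r / 2)" | "y \<notin> cball x (r / 2)" "y \<in> cball 0 (2 * r)"
          | "y \<in> - ball 0 (2 * r)" by fastforce
        then show ?case
        proof cases
          case 1
          have "r / 2 \<le> 1 + norm y" using 1 tri by (simp add: dist_norm r_def)
          then have "(1 + norm y) powr (- \<beta>) \<le> (r / 2) powr (- \<beta>)"
            using r \<alpha> \<beta> by (intro powr_mono2') auto
          then have "(1 + norm y) powr (- \<beta>) * norm (x - y) powr (- ?N)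
              \<le> (r / 2) powr (- \<beta>) * norm (x - y) powr (- ?N)"
            by (rule mult_right_mono) simp
          then have "ennreal ((1 + norm y) powr (- \<beta>) / norm (x - y) powr ?N)
              \<le> ennreal ((r / 2) powr (- \<beta>)) * ?k ?N (cball x (r / 2)) x y"
            unfolding kern using 1 by (simp add: ennreal_leI ennreal_mult'[symmetric])
          then show ?thesis by (rule order_trans) (simp add: add.assoc)
        next
          case 2
          have "(1 + norm y) powr (- \<beta>) * norm (x - y) powr (- ?N)
              \<le> norm y powr (- \<beta>) * (r / 2) powr (- ?N)"
            using 2 r elim \<alpha> \<beta> by (intro mult_mono powr_mono2') (auto simp: dist_norm)
          then have "ennreal ((1 + norm y) powr (- \<beta>) / norm (x - y) powr ?N)
              \<le> ennreal ((r / 2) powr (- ?N)) * ?k \<beta> (cball 0 (2 * r)) 0 y"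
            unfolding kern using 2 by (simp add: ennreal_leI mult.commute ennreal_mult'[symmetric])
          then show ?thesis by (rule order_trans) (simp add: add.assoc add.left_commute)
        next
          case 3
          have "norm y / 2 \<le> norm (x - y)" using 3 tri by (simp add: r_def)
          then have "(1 + norm y) powr (- \<beta>) * norm (x - y) powr (- ?N)
              \<le> norm y powr (- \<beta>) * (norm y / 2) powr (- ?N)"
            using elim \<alpha> \<beta> by (intro mult_mono powr_mono2') auto
          also have "\<dots> = 2 powr ?N * norm y powr (- (?N + \<beta>))"
          proof -
            have "t powr (- b) * (t / 2) powr (- a) = 2 powr a * t powr (- (a + b))" if "0 < t" for t a b :: real
            proof -
              have "t powr (- (a + b)) = t powr (- a) * t powr (- b)" by (simp flip: powr_add)
              moreover have "(t / 2) powr (- a) = 2 powr a * t powr (- a)"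
                using that by (simp add: powr_divide powr_minus_divide)
              ultimately show ?thesis by (simp only: mult_ac)
            qed
            from this[of "norm y" \<beta> ?N] show ?thesis using elim by simp
          qed
          finally have "ennreal ((1 + norm y) powr (- \<beta>) / norm (x - y) powr ?N)
              \<le> ennreal (2 powr ?N) * ?k (?N + \<beta>) (- ball 0 (2 * r)) 0 y"
            unfolding kern using 3 by (simp add: ennreal_leI ennreal_mult'[symmetric])
          then show ?thesis by (rule order_trans) simp
        qed
      qed
    qed
    also have "\<dots> = ennreal ((r / 2) powr (- \<beta>)) * (\<integral>\<^sup>+y. ?k ?N (cball x (r / 2)) x y \<partial>lebesgue)
          + ennreal ((r / 2) powr (- ?N)) * (\<integral>\<^sup>+y. ?k \<beta> (cball 0 (2 * r)) 0 y \<partial>lebesgue)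
          + ennreal (2 powr ?N) * (\<integral>\<^sup>+y. ?k (?N + \<beta>) (- ball 0 (2 * r)) 0 y \<partial>lebesgue)"
    proof -
      have lin: "(\<integral>\<^sup>+y. c1 * f1 y + c2 * f2 y + c3 * f3 y \<partial>lebesgue)
          = c1 * (\<integral>\<^sup>+y. f1 y \<partial>lebesgue) + c2 * (\<integral>\<^sup>+y. f2 y \<partial>lebesgue) + c3 * (\<integral>\<^sup>+y. f3 y \<partial>lebesgue)"
        if "f1 \<in> borel_measurable lebesgue" "f2 \<in> borel_measurable lebesgue" "f3 \<in> borel_measurable lebesgue"
        for f1 f2 f3 :: "real^'n \<Rightarrow> ennreal" and c1 c2 c3
        using that by (simp add: nn_integral_add nn_integral_cmult)
      have k: "?k s D z \<in> borel_measurable lebesgue" if [measurable]: "D \<in> sets borel" for s D z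
      proof -
        have "?k s D z \<in> borel_measurable borel" by measurable
        then show ?thesis by (intro measurable_completion) simp
      qed
      show ?thesis by (rule lin) (rule k, simp)+
    qed
    also have "\<dots> \<le> ennreal ((r / 2) powr (- \<beta>)) * ennreal (C1 * (r / 2) powr (?n - ?N))
          + ennreal ((r / 2) powr (- ?N)) * ennreal (C2 * (2 * r) powr (?n - \<beta>))
          + ennreal (2 powr ?N) * ennreal (C3 * (2 * r) powr (?n - (?N + \<beta>)))"
      using r by (intro add_mono mult_left_mono C1 C2 C3) auto
    also have "\<dots> = ennreal ((r / 2) powr (- \<beta>) * (C1 * (r / 2) powr (?n - ?N))
          + (r / 2) powr (- ?N) * (C2 * (2 * r) powr (?n - \<beta>))
          + 2 powr ?N * (C3 * (2 * r) powr (?n - (?N + \<beta>))))"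
      using C1(1) C2(1) C3(1) by (simp add: ennreal_plus ennreal_mult)
    also have "(r / 2) powr (- \<beta>) * (C1 * (r / 2) powr (?n - ?N))
          + (r / 2) powr (- ?N) * (C2 * (2 * r) powr (?n - \<beta>))
          + 2 powr ?N * (C3 * (2 * r) powr (?n - (?N + \<beta>))) = ?K * r powr (\<alpha> - \<beta>)"
    proof -
      have scale: "(r / 2) powr (- b) * (r / 2) powr a = 2 powr (b - a) * r powr (a - b)"
        "(r / 2) powr (- a) * (2 * r) powr b = 2 powr (a + b) * r powr (b - a)"
        "2 powr a * (2 * r) powr b = 2 powr (a + b) * r powr b" for a b
        using r by (simp_all add: powr_divide powr_mult powr_minus powr_diff powr_add field_simps)
      have "?n - ?N - \<beta> = \<alpha> - \<beta>" "?n - \<beta> - ?N = \<alpha> - \<beta>" "?n - (?N + \<beta>) = \<alpha> - \<beta>" by simp_all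
      then show ?thesis using scale(1)[of \<beta> "?n - ?N"] scale(2)[of ?N "?n - \<beta>"] scale(3)[of ?N "?n - (?N + \<beta>)"]
        by (simp only: distrib_right mult.assoc mult.left_commute[of _ C1] mult.left_commute[of _ C2] mult.left_commute[of _ C3])
    qed
    finally show "riesz_integral \<alpha> (\<lambda>y. (1 + norm y) powr (- \<beta>)) x
        \<le> ennreal (?K * (1 + norm x) powr (\<alpha> - \<beta>))"
      by (simp add: r_def)
  qed
qed

text \<open>
  Two-sided comparability is all that a double bounded coefficient has to absorb: the coefficient
  is the quotient of the two sides.
\<close>

lemma bracket_riesz_solution:
  fixes \<alpha> \<beta> :: real
  assumes \<alpha>: "0 < \<alpha>" "\<alpha> < real CARD('n::finite)" and \<beta>: "\<alpha> < \<beta>" "\<beta> < real CARD('n)"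
  shows "\<exists>c :: real^'n \<Rightarrow> real. double_bounded c \<and>
    (\<forall>x. ennreal ((1 + norm x) powr (\<alpha> - \<beta>))
      = ennreal (c x) * riesz_integral \<alpha> (\<lambda>y. (1 + norm y) powr (- \<beta>)) x)"
proof -
  let ?I = "riesz_integral \<alpha> (\<lambda>y::real^'n. (1 + norm y) powr (- \<beta>))"
  let ?g = "\<lambda>x::real^'n. (1 + norm x) powr (\<alpha> - \<beta>)"
  define L where "L = unit_ball_vol (real CARD('n)) * 2 powr (- (real CARD('n) - \<alpha> + \<beta>))"
  have L: "0 < L" by (simp add: L_def)
  have lower: "ennreal (L * ?g x) \<le> ?I x" for x
    using riesz_integral_bracket_ge[of \<alpha> \<beta> x] \<alpha> \<beta> by (simp add: L_def)
  obtain K where upper: "\<And>x. ?I x \<le> ennreal (K * ?g x)"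
    using riesz_integral_bracket_le[OF \<alpha> \<beta>] by blast
  define J where "J x = enn2real (?I x)" for x
  have I: "?I x = ennreal (J x)" for x
    using upper[of x] by (auto simp: J_def ennreal_enn2real_if top_unique)
  have g: "0 < ?g x" for x
    using add_pos_nonneg[OF zero_less_one norm_ge_zero[of x]] by simp
  have low: "L * ?g x \<le> J x" for x
    using lower[of x] unfolding I by (simp add: J_def)
  have J: "0 < J x" for x
    using low[of x] mult_pos_pos[OF L g[of x]] by linarith
  have K: "0 < K * ?g x" for x
    using upper[of x] J[of x] unfolding I by (metis ennreal_le_iff2 not_le order_less_le_trans)
  then have K0: "0 < K" using g[of 0] by (simp add: zero_less_mult_iff)
  have up: "J x \<le> K * ?g x" for x
    using upper[of x] K[of x] unfolding I by (simp add: less_imp_le)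
  define C where "C = max K (1 / L)"
  have C: "0 < C" using K0 by (simp add: C_def)
  have "1 / C \<le> ?g x / J x \<and> ?g x / J x \<le> C" for x
  proof
    have "J x \<le> C * ?g x"
    proof (rule order_trans[OF up])
      show "K * ?g x \<le> C * ?g x" by (rule mult_right_mono) (simp_all add: C_def)
    qed
    then show "1 / C \<le> ?g x / J x" using C J[of x] by (simp add: field_simps)
    have "?g x / J x \<le> 1 / L" using low[of x] J[of x] L by (simp add: field_simps)
    then show "?g x / J x \<le> C" by (simp add: C_def)
  qed
  then have "double_bounded (\<lambda>x. ?g x / J x)"
    unfolding double_bounded_def using C by blast
  moreover have "ennreal (?g x) = ennreal (?g x / J x) * ?I x" for x
    using J[of x] g[of x] unfolding I by (simp add: ennreal_mult'[symmetric])
  ultimately show ?thesis by blast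
qed

section \<open>Growth of the mass in balls\<close>

text \<open>
  Here \<open>a r\<close> is the mass of a ball of radius \<open>r\<close>. If \<open>m \<le> 1\<close>, the inequality \<open>self\<close>
  contradicts the upper bound for large \<open>r\<close>. If \<open>m > 1\<close> and \<open>e \<ge> 0\<close>, it bounds \<open>a\<close>, whereas
  \<open>incr\<close> adds a fixed amount at every doubling of the radius. The second argument includes the
  borderline \<open>e = 0\<close>, in which \<open>self\<close> alone gives no contradiction.
\<close>

lemma growth_dichotomy:
  fixes a :: "real \<Rightarrow> real" and m e :: real
  assumes mono: "\<And>r s. 0 < r \<Longrightarrow> r \<le> s \<Longrightarrow> a r \<le> a s"
    and pos: "0 < a 1"
    and upper: "\<And>r. 0 < r \<Longrightarrow> a r \<le> M * r powr N"
    and self: "\<And>r. 0 < r \<Longrightarrow> K * r powr e * a r powr m \<le> a r"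
    and incr: "\<And>r. 0 < r \<Longrightarrow> a r + K * r powr e * a r powr m \<le> a (2 * r)"
    and K: "0 < K" and e: "e + N * (m - 1) > 0"
  shows "1 < m \<and> e < 0"
proof -
  have apos: "0 < a r" if "1 \<le> r" for r
    using mono[of 1 r] pos that by linarith
  have m: "1 < m"
  proof (rule ccontr)
    assume "\<not> 1 < m"
    then have m1: "m \<le> 1" by simp
    have M: "0 < M" using upper[of 1] pos by simp
    define d where "d = e + N * (m - 1)"
    have bound: "r powr d \<le> M powr (1 - m) / K" if r: "1 \<le> r" for r
    proof -
      have "K * r powr e = (K * r powr e * a r powr m) * a r powr (- m)"
        using apos[OF r] by (simp add: powr_minus field_simps)
      also have "\<dots> \<le> a r * a r powr (- m)"
        using self[of r] r by (intro mult_right_mono) auto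
      also have "\<dots> = a r powr (1 - m)"
        using apos[OF r] by (simp add: powr_diff powr_minus divide_inverse)
      also have "\<dots> \<le> (M * r powr N) powr (1 - m)"
        using upper[of r] apos[OF r] r m1 by (intro powr_mono2) auto
      also have "\<dots> = M powr (1 - m) * r powr (N * (1 - m))"
        using M r by (simp add: powr_mult powr_powr)
      finally have "K * r powr e * r powr (- (N * (1 - m)))
          \<le> M powr (1 - m) * r powr (N * (1 - m)) * r powr (- (N * (1 - m)))"
        by (rule mult_right_mono) simp
      moreover have "r powr e * r powr (- (N * (1 - m))) = r powr d"
        unfolding d_def by (simp add: algebra_simps flip: powr_add)
      moreover have "r powr (N * (1 - m)) * r powr (- (N * (1 - m))) = 1"
        using r by (simp flip: powr_add)
      ultimately have "K * r powr d \<le> M powr (1 - m)"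
        by (simp add: mult.assoc)
      then show ?thesis using K by (simp add: field_simps)
    qed
    (* t powr (1 / d) is a radius at which the bound fails. *)
    define t where "t = M powr (1 - m) / K + 1"
    have d: "0 < d" using e by (simp add: d_def)
    have t: "1 \<le> t" using K by (simp add: t_def)
    have "1 \<le> t powr (1 / d)" using t d by (intro ge_one_powr_ge_zero) auto
    from bound[OF this] have "t \<le> M powr (1 - m) / K"
      using t d by (simp add: powr_powr)
    then show False by (simp add: t_def)
  qed
  moreover have "e < 0"
  proof (rule ccontr)
    assume "\<not> e < 0"
    then have e0: "0 \<le> e" by simp
    have L: "a r \<le> (1 / K) powr (1 / (m - 1))" if r: "1 \<le> r" for r
    proof -
      have "K * a r powr m \<le> K * r powr e * a r powr m"
        using ge_one_powr_ge_zero[OF r e0] K by (simp add: mult_right_mono)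
      also have "\<dots> \<le> a r" using self[of r] r by simp
      finally have "K * a r powr m * a r powr (-1) \<le> a r * a r powr (-1)"
        by (rule mult_right_mono) simp
      moreover have "a r powr m * a r powr (-1) = a r powr (m - 1)"
        using apos[OF r] by (simp add: powr_diff powr_minus divide_inverse)
      moreover have "a r * a r powr (-1) = 1"
        using apos[OF r] by (simp add: powr_minus)
      ultimately have "a r powr (m - 1) \<le> 1 / K"
        using K by (simp add: field_simps)
      then have "(a r powr (m - 1)) powr (1 / (m - 1)) \<le> (1 / K) powr (1 / (m - 1))"
        using m by (intro powr_mono2) auto
      then show ?thesis using m apos[OF r] by (simp add: powr_powr)
    qed
    define h where "h = K * a 1 powr m"
    have h: "0 < h" using K pos by (simp add: h_def)
    (* Boundedness is contradicted because every doubling of the radius adds at least h. *)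
    have step: "real k * h \<le> a (2 ^ k)" for k
    proof (induction k)
      case 0 then show ?case using pos by simp
    next
      case (Suc k)
      have one: "(1::real) \<le> 2 ^ k" by simp
      have "a 1 powr m \<le> a (2 ^ k) powr m"
        using mono[of 1 "2 ^ k"] one pos m by (intro powr_mono2) auto
      also have "\<dots> \<le> (2 ^ k) powr e * a (2 ^ k) powr m"
        using mult_right_mono[OF ge_one_powr_ge_zero[OF one e0], of "a (2 ^ k) powr m"] by simp
      finally have "h \<le> K * (2 ^ k) powr e * a (2 ^ k) powr m"
        using K by (simp add: h_def mult.assoc)
      with incr[of "2 ^ k"] Suc show ?case by (simp add: algebra_simps)
    qed
    obtain k :: nat where "(1 / K) powr (1 / (m - 1)) < real k * h"
      using reals_Archimedean3[OF h] by blast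
    with step[of k] L[of "2 ^ k"] show False by simp
  qed
  ultimately show ?thesis by simp
qed

definition ball_mass :: "(real ^ 'n::finite \<Rightarrow> real) \<Rightarrow> real \<Rightarrow> real" where
  "ball_mass f r = enn2real (\<integral>\<^sup>+y. ennreal (f y) * indicator (cball 0 r) y \<partial>lebesgue)"

text \<open>
  A potential that is finite at a single point makes the mass of every ball finite, and it decays
  no faster than the kernel.
\<close>

lemma riesz_integral_ge_ball_mass:
  fixes f u :: "real ^ 'n::finite \<Rightarrow> real"
  assumes \<alpha>: "\<alpha> \<le> real CARD('n)"
    and f: "f \<in> borel_measurable lebesgue" "\<And>y. 0 \<le> f y"
    and u: "\<And>x. 0 < u x" and C: "0 < C"
    and le: "\<And>x. riesz_integral \<alpha> f x \<le> ennreal (C * u x)"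
    and d: "0 < d" "norm x + r \<le> d"
  shows "(\<integral>\<^sup>+y. ennreal (f y) * indicator (cball 0 r) y \<partial>lebesgue) = ennreal (ball_mass f r)"
    and "d powr (- (real CARD('n) - \<alpha>)) * ball_mass f r \<le> C * u x"
proof -
  let ?M = "\<integral>\<^sup>+y. ennreal (f y) * indicator (cball 0 r) y \<partial>lebesgue"
  let ?k = "d powr (- (real CARD('n) - \<alpha>))"
  have "ennreal ?k * ?M \<le> riesz_integral \<alpha> f x"
  proof (rule riesz_integral_ge[OF f])
    show "norm (x - y) \<le> d" if "y \<in> cball 0 r" for y
      using that d norm_triangle_ineq4[of x y] by simp
  qed (use \<alpha> in auto)
  also note le
  finally have *: "ennreal ?k * ?M \<le> ennreal (C * u x)" .
  have "?M \<noteq> top"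
  proof
    assume "?M = top"
    then have "ennreal ?k * ?M = top" using d by (simp add: ennreal_mult_top)
    with * show False by (simp add: top_unique)
  qed
  then show M: "?M = ennreal (ball_mass f r)" by (simp add: ball_mass_def ennreal_enn2real_if)
  have "0 \<le> C * u x" using C u[of x] by simp
  then show "?k * ball_mass f r \<le> C * u x"
    using * unfolding M by (simp add: ennreal_mult'[symmetric])
qed

text \<open>
  On the ball of radius \<open>2 * r\<close> the potential of \<open>f\<close>, and hence \<open>u\<close>, is at least of order
  \<open>r powr (- (n - \<alpha>))\<close> times the mass of \<open>f\<close> in the ball of radius \<open>r\<close>; this is integrated over
  \<open>S\<close>. The set \<open>S\<close> will be the ball of radius \<open>r\<close> and the annulus between the radii \<open>r\<close> and
  \<open>2 * r\<close>.
\<close>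

lemma nn_integral_powr_ge_ball_mass:
  fixes f u :: "real ^ 'n::finite \<Rightarrow> real"
  assumes \<alpha>: "\<alpha> \<le> real CARD('n)" and p: "0 < p"
    and f: "f \<in> borel_measurable lebesgue" "\<And>y. 0 \<le> f y"
    and u: "\<And>x. 0 < u x" and C: "0 < C"
    and le: "\<And>x. riesz_integral \<alpha> f x \<le> ennreal (C * u x)"
    and r: "0 < r"
    and S: "S \<in> sets lebesgue" "S \<subseteq> cball 0 (2 * r)"
      "ennreal (unit_ball_vol (real CARD('n)) * r powr real CARD('n)) \<le> emeasure lebesgue S"
  shows "ennreal (unit_ball_vol (real CARD('n)) * (3 powr (- (real CARD('n) - \<alpha>)) / C) powr p
      * r powr (real CARD('n) - (real CARD('n) - \<alpha>) * p) * ball_mass f r powr p)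
    \<le> (\<integral>\<^sup>+y. ennreal (u y powr p) * indicator S y \<partial>lebesgue)"
proof -
  let ?n = "real CARD('n)"
  let ?\<omega> = "unit_ball_vol ?n"
  define N where "N = ?n - \<alpha>"
  define m where "m = (3 * r) powr (- N) * ball_mass f r / C"
  have m0: "0 \<le> m" using C by (simp add: m_def ball_mass_def)
  (* Points of S and of the ball of radius r have distance at most 3 r. *)
  have m: "m \<le> u x" if "x \<in> S" for x
  proof -
    have "norm x + r \<le> 3 * r" using that S(2) by auto
    then have "(3 * r) powr (- N) * ball_mass f r \<le> C * u x"
      using riesz_integral_ge_ball_mass(2)[OF \<alpha> f u C le, of "3 * r" x r] r by (simp add: N_def)
    then show ?thesis using C by (simp add: m_def field_simps)
  qed
  have "?\<omega> * (3 powr (- N) / C) powr p * r powr (?n - N * p) * ball_mass f r powr p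
      = m powr p * (?\<omega> * r powr ?n)"
  proof -
    have m_eq: "m = (3 powr (- N) / C) * r powr (- N) * ball_mass f r"
      using r by (simp add: m_def powr_mult)
    have "m powr p = (3 powr (- N) / C) powr p * r powr (- (N * p)) * ball_mass f r powr p"
    proof (subst m_eq)
      have split: "(a * b * c) powr p = a powr p * b powr p * c powr p"
        if "0 \<le> a" "0 \<le> b" "0 \<le> c" for a b c :: real
        using that by (simp add: powr_mult)
      have "0 \<le> 3 powr (- N) / C" "0 \<le> r powr (- N)" "0 \<le> ball_mass f r"
        using C by (auto simp: ball_mass_def)
      from split[OF this] show "(3 powr (- N) / C * r powr (- N) * ball_mass f r) powr p
          = (3 powr (- N) / C) powr p * r powr (- (N * p)) * ball_mass f r powr p"
        by (simp only: powr_powr mult_minus_left)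
    qed
    moreover have "r powr (?n - N * p) = r powr (- (N * p)) * r powr ?n"
      by (simp flip: powr_add)
    ultimately show ?thesis by simp
  qed
  then have "ennreal (?\<omega> * (3 powr (- N) / C) powr p * r powr (?n - N * p) * ball_mass f r powr p)
      = ennreal (m powr p) * ennreal (?\<omega> * r powr ?n)"
    by (simp add: ennreal_mult'[symmetric])
  also have "\<dots> \<le> ennreal (m powr p) * emeasure lebesgue S"
    by (intro mult_left_mono S) simp
  also have "\<dots> = (\<integral>\<^sup>+y. ennreal (m powr p) * indicator S y \<partial>lebesgue)"
    using S by (simp add: nn_integral_cmult_indicator)
  also have "\<dots> \<le> (\<integral>\<^sup>+y. ennreal (u y powr p) * indicator S y \<partial>lebesgue)"
  proof (intro nn_integral_mono)
    fix y
    show "ennreal (m powr p) * indicator S y \<le> ennreal (u y powr p) * indicator S y"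
      using m[of y] m0 p by (auto simp: indicator_def intro!: ennreal_leI powr_mono2)
  qed
  finally show ?thesis by (simp add: N_def)
qed

text \<open>
  The mass of \<open>u powr p\<close> bounds the mass of \<open>v powr q\<close> from below on the same ball, and that
  one bounds the integral of \<open>u powr p\<close> over \<open>S\<close>. The powers of \<open>r\<close> collected in the two steps
  add up to \<open>(n - N * p) + (n - N * q) * p\<close>, which is the exponent displayed.
\<close>

lemma ball_mass_self_improvement:
  fixes u v :: "real ^ 'n::finite \<Rightarrow> real" and p q C \<alpha> :: real
  defines "n \<equiv> real CARD('n)"
  defines "N \<equiv> n - \<alpha>"
  assumes \<alpha>: "\<alpha> \<le> n" and p: "0 < p" and q: "0 < q" and C: "0 < C"
    and meas: "u \<in> borel_measurable lebesgue" "v \<in> borel_measurable lebesgue"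
    and u: "\<And>x. 0 < u x" and v: "\<And>x. 0 < v x"
    and leu: "\<And>x. riesz_integral \<alpha> (\<lambda>y. v y powr q) x \<le> ennreal (C * u x)"
    and lev: "\<And>x. riesz_integral \<alpha> (\<lambda>y. u y powr p) x \<le> ennreal (C * v x)"
  obtains K where "0 < K"
    "\<And>r S. 0 < r \<Longrightarrow> S \<in> sets lebesgue \<Longrightarrow> S \<subseteq> cball 0 (2 * r) \<Longrightarrow>
      ennreal (unit_ball_vol n * r powr n) \<le> emeasure lebesgue S \<Longrightarrow>
      ennreal (K * r powr (\<alpha> * (p + 1) - N * (p * q - 1)) * ball_mass (\<lambda>y. u y powr p) r powr (p * q))
        \<le> (\<integral>\<^sup>+y. ennreal (u y powr p) * indicator S y \<partial>lebesgue)"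
proof
  have \<alpha>': "\<alpha> \<le> real CARD('n)" using \<alpha> by (simp add: n_def)
  have up: "\<And>y. 0 \<le> u y powr p" and vq: "\<And>y. 0 \<le> v y powr q" by simp_all
  have mu: "(\<lambda>y. u y powr p) \<in> borel_measurable lebesgue" and mv: "(\<lambda>y. v y powr q) \<in> borel_measurable lebesgue"
    using meas by measurable
  let ?a = "ball_mass (\<lambda>y. u y powr p)" and ?b = "ball_mass (\<lambda>y. v y powr q)"
  define Kp where "Kp = unit_ball_vol n * (3 powr (- N) / C) powr p"
  define Kq where "Kq = unit_ball_vol n * (3 powr (- N) / C) powr q"
  have n: "0 \<le> n" by (simp add: n_def)
  have Kp: "0 < Kp" and Kq: "0 < Kq" using C n by (simp_all add: Kp_def Kq_def)
  show "0 < Kp * Kq powr p" using Kp Kq by simp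
  fix r :: real and S :: "(real^'n) set"
  assume r: "0 < r" and S: "S \<in> sets lebesgue" "S \<subseteq> cball 0 (2 * r)"
    and vol: "ennreal (unit_ball_vol n * r powr n) \<le> emeasure lebesgue S"
  have a0: "0 \<le> ?a r" by (simp add: ball_mass_def)
  have "ennreal (Kq * r powr (n - N * q) * ?a r powr q) \<le> ennreal (?b r)"
  proof -
    have "ennreal (Kq * r powr (n - N * q) * ?a r powr q)
        \<le> (\<integral>\<^sup>+y. ennreal (v y powr q) * indicator (cball 0 r) y \<partial>lebesgue)"
      unfolding Kq_def N_def n_def
    proof (rule nn_integral_powr_ge_ball_mass[OF \<alpha>' q mu up v C lev r])
      show "ennreal (unit_ball_vol (real CARD('n)) * r powr real CARD('n)) \<le> emeasure lebesgue (cball (0::real^'n) r)"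
        using r by (subst emeasure_lebesgue_cball) auto
    qed (use r in auto)
    also have "\<dots> = ennreal (?b r)"
      by (rule riesz_integral_ge_ball_mass(1)[OF \<alpha>' mv vq u C leu r, of 0]) simp
    finally show ?thesis .
  qed
  then have "Kq * r powr (n - N * q) * ?a r powr q \<le> ?b r"
    by (simp add: ball_mass_def)
  then have "(Kq * r powr (n - N * q) * ?a r powr q) powr p \<le> ?b r powr p"
    using Kq p by (intro powr_mono2) auto
  moreover have "(Kq * r powr (n - N * q) * ?a r powr q) powr p
      = Kq powr p * r powr ((n - N * q) * p) * ?a r powr (p * q)"
  proof -
    have split: "(a * b * c) powr p = a powr p * b powr p * c powr p"
      if "0 \<le> a" "0 \<le> b" "0 \<le> c" for a b c :: real
      using that by (simp add: powr_mult)
    show ?thesis using Kq by (subst split) (simp_all add: powr_powr mult.commute)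
  qed
  ultimately have "Kp * r powr (n - N * p) * (Kq powr p * r powr ((n - N * q) * p) * ?a r powr (p * q))
      \<le> Kp * r powr (n - N * p) * ?b r powr p"
    using Kp by (intro mult_left_mono) auto
  moreover have "r powr (\<alpha> * (p + 1) - N * (p * q - 1)) = r powr (n - N * p) * r powr ((n - N * q) * p)"
    unfolding powr_add[symmetric] N_def by (rule arg_cong[of _ _ "\<lambda>e. r powr e"]) (simp add: algebra_simps)
  ultimately have "Kp * Kq powr p * r powr (\<alpha> * (p + 1) - N * (p * q - 1)) * ?a r powr (p * q)
      \<le> Kp * r powr (n - N * p) * ?b r powr p"
    by (simp only: mult_ac)
  then have "ennreal (Kp * Kq powr p * r powr (\<alpha> * (p + 1) - N * (p * q - 1)) * ?a r powr (p * q))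
      \<le> ennreal (Kp * r powr (n - N * p) * ?b r powr p)"
    by (rule ennreal_leI)
  also have "\<dots> \<le> (\<integral>\<^sup>+y. ennreal (u y powr p) * indicator S y \<partial>lebesgue)"
    unfolding Kp_def N_def n_def
    by (rule nn_integral_powr_ge_ball_mass[OF \<alpha>' p mv vq u C leu r S vol[unfolded n_def]])
  finally show "ennreal (Kp * Kq powr p * r powr (\<alpha> * (p + 1) - N * (p * q - 1)) * ?a r powr (p * q))
      \<le> (\<integral>\<^sup>+y. ennreal (u y powr p) * indicator S y \<partial>lebesgue)" .
qed

lemma emeasure_lebesgue_annulus_ge:
  fixes r :: real
  assumes r: "0 < r"
  shows "ennreal (unit_ball_vol (real DIM('a::euclidean_space)) * r powr real DIM('a))
    \<le> emeasure lebesgue (cball (0::'a) (2 * r) - cball 0 r)"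
proof -
  let ?n = "real DIM('a)"
  have "emeasure lebesgue (cball (0::'a) (2 * r) - cball 0 r)
      = emeasure lebesgue (cball (0::'a) (2 * r)) - emeasure lebesgue (cball (0::'a) r)"
    using r emeasure_lebesgue_cball[OF r, of "0::'a"] by (intro emeasure_Diff) auto
  also have "\<dots> = ennreal (unit_ball_vol ?n * (2 * r) powr ?n - unit_ball_vol ?n * r powr ?n)"
    using r emeasure_lebesgue_cball[OF r, of "0::'a"] emeasure_lebesgue_cball[of "2 * r" "0::'a"]
    by (simp only: ennreal_minus) (simp add: ennreal_minus)
  finally have "emeasure lebesgue (cball (0::'a) (2 * r) - cball 0 r)
      = ennreal (unit_ball_vol ?n * (2 * r) powr ?n - unit_ball_vol ?n * r powr ?n)" .
  moreover have "unit_ball_vol ?n * r powr ?n \<le> unit_ball_vol ?n * (2 * r) powr ?n - unit_ball_vol ?n * r powr ?n"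
  proof -
    have "(2::real) powr 1 \<le> 2 powr ?n" using DIM_positive[where 'a = 'a] by (intro powr_mono) (auto simp: Suc_le_eq)
    then have "2 * (unit_ball_vol ?n * r powr ?n) \<le> 2 powr ?n * (unit_ball_vol ?n * r powr ?n)"
      by (intro mult_right_mono) auto
    then show ?thesis using r by (simp add: powr_mult mult_ac)
  qed
  ultimately show ?thesis by (simp add: ennreal_leI)
qed

text \<open>
  The mass of \<open>u powr p\<close> in balls satisfies the hypotheses of \<open>growth_dichotomy\<close> with
  \<open>m = p * q\<close>. Those on \<open>u\<close> and \<open>v\<close> are symmetric, so the other half of the condition follows
  by exchanging \<open>u\<close> with \<open>v\<close> and \<open>p\<close> with \<open>q\<close>.
\<close>

lemma subcritical_exponents:
  fixes u v :: "real ^ 'n::finite \<Rightarrow> real" and p q C \<alpha> :: real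
  defines "N \<equiv> real CARD('n) - \<alpha>"
  assumes \<alpha>: "0 < \<alpha>" "\<alpha> < real CARD('n)" and p: "0 < p" and q: "0 < q" and C: "0 < C"
    and meas: "u \<in> borel_measurable lebesgue" "v \<in> borel_measurable lebesgue"
    and u: "\<And>x. 0 < u x" and v: "\<And>x. 0 < v x"
    and leu: "\<And>x. riesz_integral \<alpha> (\<lambda>y. v y powr q) x \<le> ennreal (C * u x)"
    and lev: "\<And>x. riesz_integral \<alpha> (\<lambda>y. u y powr p) x \<le> ennreal (C * v x)"
  shows "1 < p * q \<and> \<alpha> * (p + 1) / (p * q - 1) < N"
proof -
  let ?a = "ball_mass (\<lambda>y. u y powr p)"
  let ?A = "\<lambda>S. \<integral>\<^sup>+y. ennreal (u y powr p) * indicator S y \<partial>lebesgue"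
  let ?e = "\<alpha> * (p + 1) - N * (p * q - 1)"
  have \<alpha>': "\<alpha> \<le> real CARD('n)" using \<alpha> by simp
  have up: "\<And>y. 0 \<le> u y powr p" by simp
  have mu: "(\<lambda>y. u y powr p) \<in> borel_measurable lebesgue" using meas by measurable
  obtain K where K: "0 < K" and improve: "\<And>r S. 0 < r \<Longrightarrow> S \<in> sets lebesgue \<Longrightarrow> S \<subseteq> cball 0 (2 * r) \<Longrightarrow>
      ennreal (unit_ball_vol (real CARD('n)) * r powr real CARD('n)) \<le> emeasure lebesgue S \<Longrightarrow>
      ennreal (K * r powr ?e * ?a r powr (p * q)) \<le> ?A S"
    using ball_mass_self_improvement[OF \<alpha>' p q C meas u v leu lev] unfolding N_def by blast
  have finite: "?A (cball 0 r) = ennreal (?a r)" if "0 < r" for r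
    by (rule riesz_integral_ge_ball_mass(1)[OF \<alpha>' mu up v C lev that, of 0]) simp
  have a0: "0 \<le> ?a r" for r by (simp add: ball_mass_def)
  have "1 < p * q \<and> ?e < 0"
  proof (rule growth_dichotomy[of ?a])
    fix r s :: real assume r: "0 < r" "r \<le> s"
    have "?A (cball 0 r) \<le> ?A (cball 0 s)"
      using r by (intro nn_integral_mono mult_left_mono) (auto simp: indicator_def)
    then show "?a r \<le> ?a s" using r finite[of r] finite[of s] a0 by simp
  next
    have "?A (cball 0 1) \<noteq> 0"
    proof
      assume "?A (cball 0 1) = 0"
      then have "AE y in lebesgue. ennreal (u y powr p) * indicator (cball 0 1) y = 0"
        using mu by (subst (asm) nn_integral_0_iff_AE)
          (auto intro!: borel_measurable_times_ennreal borel_measurable_indicator)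
      then have "AE y in lebesgue. y \<notin> cball (0::real^'n) 1"
      proof eventually_elim
        case (elim y)
        have "0 < u y powr p" using u[of y] by simp
        then show ?case using elim by (auto simp: indicator_def split: if_splits)
      qed
      then have "emeasure lebesgue (cball (0::real^'n) 1) = 0"
        by (subst (asm) AE_iff_measurable[OF _ refl]) (auto simp: cball_def)
      then have "unit_ball_vol (real CARD('n)) \<le> 0"
        using emeasure_lebesgue_cball[of 1 "0::real^'n"] by (simp add: ennreal_eq_0_iff)
      moreover have "0 < unit_ball_vol (real CARD('n))" by (rule unit_ball_vol_pos) simp
      ultimately show False by linarith
    qed
    then show "0 < ?a 1" using finite[of 1] a0[of 1] by (auto simp: less_le)
  next
    fix r :: real assume r: "0 < r"
    have "r powr (- N) * ?a r \<le> C * v 0"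
      unfolding N_def by (rule riesz_integral_ge_ball_mass(2)[OF \<alpha>' mu up v C lev r]) simp
    then have "r powr (- N) * ?a r * r powr N \<le> C * v 0 * r powr N"
      by (rule mult_right_mono) simp
    then show "?a r \<le> C * v 0 * r powr N"
      using r by (simp add: powr_minus field_simps)
  next
    fix r :: real assume r: "0 < r"
    have "ennreal (K * r powr ?e * ?a r powr (p * q)) \<le> ?A (cball 0 r)"
    proof (rule improve[OF r])
      show "ennreal (unit_ball_vol (real CARD('n)) * r powr real CARD('n)) \<le> emeasure lebesgue (cball (0::real^'n) r)"
        using r by (subst emeasure_lebesgue_cball) auto
    qed (use r in auto)
    then show "K * r powr ?e * ?a r powr (p * q) \<le> ?a r"
      using finite[OF r] a0 by simp
    (* The annulus has at least the volume of the inner ball, so it receives the same lower bound. *)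
    let ?S = "cball (0::real^'n) (2 * r) - cball 0 r"
    have "ennreal (K * r powr ?e * ?a r powr (p * q)) \<le> ?A ?S"
    proof (rule improve[OF r])
      show "ennreal (unit_ball_vol (real CARD('n)) * r powr real CARD('n)) \<le> emeasure lebesgue ?S"
        using emeasure_lebesgue_annulus_ge[OF r, where 'a = "real^'n"] by simp
    qed auto
    then have "ennreal (?a r + K * r powr ?e * ?a r powr (p * q)) \<le> ?A (cball 0 r) + ?A ?S"
      using finite[OF r] a0[of r] K by (simp add: ennreal_plus add_left_mono)
    also have "\<dots> = (\<integral>\<^sup>+y. ennreal (u y powr p) * indicator (cball 0 r) y
        + ennreal (u y powr p) * indicator ?S y \<partial>lebesgue)"
      using mu by (intro nn_integral_add[symmetric] borel_measurable_times_ennreal borel_measurable_indicator) auto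
    also have "\<dots> = ?A (cball 0 (2 * r))"
      using r by (intro nn_integral_cong) (auto simp: indicator_def)
    finally show "?a r + K * r powr ?e * ?a r powr (p * q) \<le> ?a (2 * r)"
      using finite[of "2 * r"] r a0 by simp
  next
    show "0 < K" by (rule K)
    show "0 < ?e + N * (p * q - 1)" using \<alpha> p by simp
  qed
  then show ?thesis by (simp add: field_simps)
qed

section \<open>Solvability of the system and of the equation\<close>

lemma double_bounded_coefficient_absorb:
  assumes c: "double_bounded c"
  obtains C where "0 < C"
    "\<And>(x::'a) t I. ennreal t = ennreal (c x) * I \<Longrightarrow> I \<le> ennreal (C * t)"
proof -
  obtain C where C: "0 < C" "\<And>x. 1 / C \<le> c x" using c unfolding double_bounded_def by blast
  show thesis
  proof
    fix x :: 'a and t I assume eq: "ennreal t = ennreal (c x) * I"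
    have "1 \<le> C * c x" using C(1) C(2)[of x] by (simp add: field_simps)
    then have "1 * I \<le> ennreal (C * c x) * I"
      by (intro mult_right_mono) auto
    also have "\<dots> = ennreal (C * t)"
      using C eq by (simp add: ennreal_mult' mult.assoc)
    finally show "I \<le> ennreal (C * t)" by simp
  qed (rule C)
qed

lemma system_solution_exponents:
  fixes u v :: "real ^ 'n::finite \<Rightarrow> real"
  assumes \<alpha>: "0 < \<alpha>" "\<alpha> < real CARD('n)" and p: "0 < p" and q: "0 < q"
    and c: "double_bounded c1" "double_bounded c2"
    and sol: "positive_system_solution \<alpha> p q c1 c2 u v"
  shows "1 < p * q \<and> max (\<alpha> * (p + 1) / (p * q - 1)) (\<alpha> * (q + 1) / (p * q - 1)) < real CARD('n) - \<alpha>"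
proof -
  obtain C1 where C1: "0 < C1" "\<And>x t I. ennreal t = ennreal (c1 x) * I \<Longrightarrow> I \<le> ennreal (C1 * t)"
    using double_bounded_coefficient_absorb[OF c(1)] by metis
  obtain C2 where C2: "0 < C2" "\<And>x t I. ennreal t = ennreal (c2 x) * I \<Longrightarrow> I \<le> ennreal (C2 * t)"
    using double_bounded_coefficient_absorb[OF c(2)] by metis
  define C where "C = max C1 C2"
  have meas: "u \<in> borel_measurable lebesgue" "v \<in> borel_measurable lebesgue"
    and u: "\<And>x. 0 < u x" and v: "\<And>x. 0 < v x"
    and eq: "\<And>x. ennreal (u x) = ennreal (c1 x) * riesz_integral \<alpha> (\<lambda>y. v y powr q) x"
      "\<And>x. ennreal (v x) = ennreal (c2 x) * riesz_integral \<alpha> (\<lambda>y. u y powr p) x"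
    using sol unfolding positive_system_solution_def by auto
  have C: "0 < C" using C1 by (simp add: C_def)
  have "C1 * u x \<le> C * u x" "C2 * v x \<le> C * v x" for x
    using u[of x] v[of x] by (auto intro!: mult_right_mono simp: C_def)
  then have leu: "\<And>x. riesz_integral \<alpha> (\<lambda>y. v y powr q) x \<le> ennreal (C * u x)"
    and lev: "\<And>x. riesz_integral \<alpha> (\<lambda>y. u y powr p) x \<le> ennreal (C * v x)"
    using C1(2)[OF eq(1)] C2(2)[OF eq(2)] by (meson ennreal_leI order_trans)+
  show ?thesis
    using subcritical_exponents[OF \<alpha> p q C meas u v leu lev]
      subcritical_exponents[OF \<alpha> q p C meas(2,1) v u lev leu]
    by (simp add: mult.commute)
qed

text \<open>
  The two decay rates are the solution \<open>s\<close>, \<open>t\<close> of \<open>s * p = \<alpha> + t\<close> and \<open>t * q = \<alpha> + s\<close>,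
  which is what makes \<open>u powr p\<close> and \<open>v powr q\<close> have potentials of the order of \<open>v\<close> and \<open>u\<close>.
  The assumed bounds on them say that \<open>\<alpha> + s\<close> and \<open>\<alpha> + t\<close> stay below the dimension.
\<close>

lemma system_solution_exists:
  fixes \<alpha> p q :: real
  assumes \<alpha>: "0 < \<alpha>" "\<alpha> < real CARD('n::finite)" and p: "0 < p" and q: "0 < q"
    and pq: "1 < p * q"
    and lt: "\<alpha> * (p + 1) / (p * q - 1) < real CARD('n) - \<alpha>" "\<alpha> * (q + 1) / (p * q - 1) < real CARD('n) - \<alpha>"
  defines "u \<equiv> \<lambda>x::real^'n. (1 + norm x) powr (- (\<alpha> * (q + 1) / (p * q - 1)))"
  defines "v \<equiv> \<lambda>x::real^'n. (1 + norm x) powr (- (\<alpha> * (p + 1) / (p * q - 1)))"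
  shows "\<exists>c1 c2. double_bounded c1 \<and> double_bounded c2 \<and> positive_system_solution \<alpha> p q c1 c2 u v"
proof -
  let ?s = "\<alpha> * (q + 1) / (p * q - 1)" and ?t = "\<alpha> * (p + 1) / (p * q - 1)"
  have st: "0 < ?s" "0 < ?t" using \<alpha> p q pq by simp_all
  have sp: "?s * p = \<alpha> + ?t" and tq: "?t * q = \<alpha> + ?s"
    using pq by (simp_all add: field_simps)
  obtain c1 where c1: "double_bounded c1" "\<And>x::real^'n. ennreal ((1 + norm x) powr (\<alpha> - (\<alpha> + ?s)))
      = ennreal (c1 x) * riesz_integral \<alpha> (\<lambda>y. (1 + norm y) powr (- (\<alpha> + ?s))) x"
    using bracket_riesz_solution[of \<alpha> "\<alpha> + ?s", where 'n = 'n] \<alpha> st lt by auto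
  obtain c2 where c2: "double_bounded c2" "\<And>x::real^'n. ennreal ((1 + norm x) powr (\<alpha> - (\<alpha> + ?t)))
      = ennreal (c2 x) * riesz_integral \<alpha> (\<lambda>y. (1 + norm y) powr (- (\<alpha> + ?t))) x"
    using bracket_riesz_solution[of \<alpha> "\<alpha> + ?t", where 'n = 'n] \<alpha> st lt by auto
  have up: "u y powr p = (1 + norm y) powr (- (\<alpha> + ?t))" for y
    unfolding u_def powr_powr mult_minus_left sp ..
  have vq: "v y powr q = (1 + norm y) powr (- (\<alpha> + ?s))" for y
    unfolding v_def powr_powr mult_minus_left tq ..
  have meas: "(\<lambda>x::real^'n. (1 + norm x) powr a) \<in> borel_measurable lebesgue" for a
  proof -
    have "(\<lambda>x::real^'n. (1 + norm x) powr a) \<in> borel_measurable borel" by measurable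
    then show ?thesis by (intro measurable_completion) simp
  qed
  have pos: "0 < (1 + norm x) powr a" for a and x :: "real^'n"
    using add_pos_nonneg[OF zero_less_one norm_ge_zero[of x]] by simp
  have "positive_system_solution \<alpha> p q c1 c2 u v"
    unfolding positive_system_solution_def up vq
    using c1(2) c2(2) meas pos by (simp add: u_def v_def)
  then show ?thesis using c1 c2 by blast
qed

text \<open>
  Both sides force \<open>p > 1\<close>, and then the factor \<open>p + 1\<close> cancels and the condition becomes \<open>\<alpha> / (p - 1) < n - \<alpha>\<close>.
\<close>

lemma scalar_condition_iff:
  fixes p \<alpha> n :: real
  assumes \<alpha>: "0 < \<alpha>" "\<alpha> < n" and p: "0 < p"
  shows "1 < p * p \<and> \<alpha> * (p + 1) / (p * p - 1) < n - \<alpha> \<longleftrightarrow> n / (n - \<alpha>) < p"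
proof (cases "1 < p")
  case True
  have "p * p - 1 = (p - 1) * (p + 1)" by (simp add: algebra_simps)
  then have "\<alpha> * (p + 1) / (p * p - 1) = \<alpha> / (p - 1)" using True by simp
  moreover have "1 < p * p" using True less_1_mult by blast
  moreover have "\<alpha> / (p - 1) < n - \<alpha> \<longleftrightarrow> n / (n - \<alpha>) < p" using True \<alpha> by (simp add: field_simps)
  ultimately show ?thesis by simp
next
  case False
  have "p * p \<le> 1" using False p by (simp add: mult_le_one)
  moreover have "1 < n / (n - \<alpha>)" using \<alpha> by simp
  ultimately show ?thesis using False by auto
qed

theorem theorem1p5:
  fixes \<alpha> p q :: real
  assumes "0 < \<alpha>" and "\<alpha> < real CARD('n::finite)" and "0 < p" and "0 < q"
  shows "((\<exists>c :: real ^ 'n \<Rightarrow> real. double_bounded c \<and>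
             (\<exists>u. positive_solution \<alpha> p c u)) \<longleftrightarrow>
           p > real CARD('n) / (real CARD('n) - \<alpha>)) \<and>
         ((\<exists>c1 c2 :: real ^ 'n \<Rightarrow> real. double_bounded c1 \<and> double_bounded c2 \<and>
             (\<exists>u v. positive_system_solution \<alpha> p q c1 c2 u v)) \<longleftrightarrow>
           p * q > 1 \<and>
           max (\<alpha> * (p + 1) / (p * q - 1)) (\<alpha> * (q + 1) / (p * q - 1)) < real CARD('n) - \<alpha>)"
proof (intro conjI iffI)
  let ?n = "real CARD('n)"
  assume "\<exists>c :: real ^ 'n \<Rightarrow> real. double_bounded c \<and> (\<exists>u. positive_solution \<alpha> p c u)"
  then obtain c u where c: "double_bounded c" "positive_solution \<alpha> p c (u :: real^'n \<Rightarrow> real)" by blast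
  then have "positive_system_solution \<alpha> p p c c u u"
    by (simp add: positive_solution_def positive_system_solution_def)
  from system_solution_exponents[OF assms(1,2,3,3) c(1) c(1) this]
  show "p > ?n / (?n - \<alpha>)" using scalar_condition_iff[OF assms(1,2,3)] by simp
next
  let ?n = "real CARD('n)"
  assume "p > ?n / (?n - \<alpha>)"
  then have "1 < p * p \<and> \<alpha> * (p + 1) / (p * p - 1) < ?n - \<alpha>"
    using scalar_condition_iff[OF assms(1,2,3)] by simp
  then obtain c1 c2 and u :: "real^'n \<Rightarrow> real" where
    "double_bounded c1" "positive_system_solution \<alpha> p p c1 c2 u u"
    using system_solution_exists[OF assms(1,2,3,3)] by blast
  then show "\<exists>c :: real ^ 'n \<Rightarrow> real. double_bounded c \<and> (\<exists>u. positive_solution \<alpha> p c u)"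
    by (auto simp: positive_solution_def positive_system_solution_def)
next
  assume "\<exists>c1 c2 :: real ^ 'n \<Rightarrow> real. double_bounded c1 \<and> double_bounded c2 \<and>
             (\<exists>u v. positive_system_solution \<alpha> p q c1 c2 u v)"
  then show "p * q > 1" "max (\<alpha> * (p + 1) / (p * q - 1)) (\<alpha> * (q + 1) / (p * q - 1)) < real CARD('n) - \<alpha>"
    using system_solution_exponents[OF assms] by blast+
next
  assume "p * q > 1 \<and> max (\<alpha> * (p + 1) / (p * q - 1)) (\<alpha> * (q + 1) / (p * q - 1)) < real CARD('n) - \<alpha>"
  then show "\<exists>c1 c2 :: real ^ 'n \<Rightarrow> real. double_bounded c1 \<and> double_bounded c2 \<and>
             (\<exists>u v. positive_system_solution \<alpha> p q c1 c2 u v)"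
    using system_solution_exists[OF assms] by fastforce
qed

end
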